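(* Let $T$ be a ring. Then either $T$ has a conch maximal subring, or $U(R)=R\cap U(T)$ for every subring $R$ of $T$ (i.e., every subring of $T$ is closed under taking inverses in $T$).
   Context: All rings are commutative with $1\neq0$ and subrings are unital. $U(R)$ denotes the group of units of $R$. A maximal subring of $T$ is a proper subring maximal with respect to inclusion among proper subrings of $T$. For a unit $x\in T$, a subring $V$ of $T$ conches $x$ in $T$ if $x^{-1}\in V$, $x\notin V$, and $V$ is maximal among subrings of $T$ containing $x^{-1}$ but not $x$. A conch maximal subring of $T$ is a maximal subring of $T$ which conches some unit $x$ of $T$. *)

theory Defs
  imports Main
begin

definition is_subring :: "'a::comm_ring_1 set \<Rightarrow> bool" where
  "is_subring S \<longleftrightarrow> 1 \<in> S \<and> (\<forall>x\<in>S. \<forall>y\<in>S. x + y \<in> S \<and> x * y \<in> S) \<and> (\<forall>x\<in>S. - x \<in> S)"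

definition maximal_subring :: "'a::comm_ring_1 set \<Rightarrow> bool" where
  "maximal_subring V \<longleftrightarrow> is_subring V \<and> V \<noteq> UNIV \<and>
     (\<forall>W. is_subring W \<and> V \<subseteq> W \<and> W \<noteq> UNIV \<longrightarrow> W = V)"

definition conches :: "'a::comm_ring_1 set \<Rightarrow> 'a \<Rightarrow> bool" where
  "conches V x \<longleftrightarrow> (\<exists>y. x * y = 1 \<and> is_subring V \<and> y \<in> V \<and> x \<notin> V \<and>
     (\<forall>W. is_subring W \<and> y \<in> W \<and> x \<notin> W \<and> V \<subseteq> W \<longrightarrow> W = V))"

definition conch_maximal_subring :: "'a::comm_ring_1 set \<Rightarrow> bool" where
  "conch_maximal_subring V \<longleftrightarrow> maximal_subring V \<and> (\<exists>x. x dvd 1 \<and> conches V x)"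

definition units_in :: "'a::comm_ring_1 set \<Rightarrow> 'a set" where
  "units_in R = {x \<in> R. \<exists>y\<in>R. x * y = 1}"

end

(* Suppose y lies in a subring R while its inverse x does not. It suffices to find a subring V with
   y in V, x not in V and V[x] = T: by Zorn V lies below a subring that conches x, and there V[x] = T
   forces maximality. Such a V is the preimage of the valuation ring of a rank one valuation with
   v(y) > 0. Since x is not in Z[y], no 1 + y h(y) vanishes, so some prime ideal of T avoids all of
   them, and one may replace T by the fraction field of the quotient. There a rank one valuation is
   first built on the field generated by y and then extended: by the Gauss extension along
   transcendental elements, and by integrality along algebraic ones. *)
theory Submission
  imports Defs "HOL-Computational_Algebra.Polynomial" "HOL-Computational_Algebra.Primes"
    "HOL-Computational_Algebra.Fraction_Field"
begin

section \<open>Subrings and conching\<close>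

text \<open>A valuation ring that merely conches x is not enough: if its rank exceeds one, V[x] can
  be a proper subring, and Zorn's lemma gives no control over the rank. No value group is used; rank
  one is expressed by saying that powers of y clear every denominator, and this has to be secured at
  each stage. In the field generated by y it comes from localizing Z[y] at (q, y), with q chosen so
  that every nonzero element divides a power of y. If y is transcendental over the rationals, then q
  = 0, because a prime q would give a local ring of dimension two. In positive characteristic q is
  the characteristic. If y is algebraic over the rationals, then q is a prime with (q, y) proper,
  and some power of y is divisible by q. That no 1 + y h(y) vanishes is exactly what keeps (q, y)
  proper.\<close>

lemma subring_one: "is_subring S \<Longrightarrow> 1 \<in> S"
  and subring_add: "is_subring S \<Longrightarrow> a \<in> S \<Longrightarrow> b \<in> S \<Longrightarrow> a + b \<in> S"
  and subring_mult: "is_subring S \<Longrightarrow> a \<in> S \<Longrightarrow> b \<in> S \<Longrightarrow> a * b \<in> S"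
  and subring_uminus: "is_subring S \<Longrightarrow> a \<in> S \<Longrightarrow> - a \<in> S"
  by (auto simp: is_subring_def)

lemma subring_zero: "is_subring S \<Longrightarrow> 0 \<in> S"
  by (metis subring_one subring_add subring_uminus add.right_inverse)

lemma subring_diff: "is_subring S \<Longrightarrow> a \<in> S \<Longrightarrow> b \<in> S \<Longrightarrow> a - b \<in> S"
  by (metis subring_add subring_uminus add_uminus_conv_diff)

lemma subring_power: "is_subring S \<Longrightarrow> a \<in> S \<Longrightarrow> a ^ n \<in> S"
  by (induction n) (auto intro: subring_one subring_mult)

lemma subring_sum: "is_subring S \<Longrightarrow> (\<And>i. i \<in> I \<Longrightarrow> f i \<in> S) \<Longrightarrow> sum f I \<in> S"
  by (induction I rule: infinite_finite_induct) (auto intro: subring_zero subring_add)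

lemma subring_of_int:
  assumes "is_subring S" shows "of_int n \<in> S"
proof -
  have "of_nat m \<in> S" for m
    by (induction m) (simp_all add: subring_zero subring_one subring_add assms)
  then show ?thesis
    by (cases n rule: int_cases2) (simp_all add: subring_uminus assms)
qed

lemmas subring_intros = subring_zero subring_one subring_add subring_mult subring_uminus
  subring_diff subring_power subring_sum subring_of_int

lemma subring_Union_chain:
  assumes chain: "subset.chain A C" and "C \<noteq> {}" and sub: "\<And>W. W \<in> A \<Longrightarrow> is_subring W"
  shows "is_subring (\<Union>C)"
proof -
  have sub': "is_subring W" if "W \<in> C" for W
    using chain sub that by (auto simp: subset.chain_def)
  have pair: "\<exists>W\<in>C. a \<in> W \<and> b \<in> W" if "a \<in> \<Union>C" "b \<in> \<Union>C" for a b
  proof -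
    obtain W1 W2 where "W1 \<in> C" "W2 \<in> C" "a \<in> W1" "b \<in> W2" using \<open>a \<in> \<Union>C\<close> \<open>b \<in> \<Union>C\<close> by blast
    moreover have "W1 \<subseteq> W2 \<or> W2 \<subseteq> W1"
      using chain \<open>W1 \<in> C\<close> \<open>W2 \<in> C\<close> by (auto simp: subset_chain_def)
    ultimately show ?thesis by blast
  qed
  show ?thesis
    unfolding is_subring_def
  proof (intro conjI ballI)
    show "1 \<in> \<Union>C" using \<open>C \<noteq> {}\<close> sub' subring_one by blast
    fix a assume a: "a \<in> \<Union>C"
    then show "- a \<in> \<Union>C" using sub' subring_uminus by blast
    fix b assume "b \<in> \<Union>C"
    then obtain W where "W \<in> C" "a \<in> W" "b \<in> W" using pair[OF a] by blast
    then show "a + b \<in> \<Union>C" "a * b \<in> \<Union>C"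
      using sub' subring_add subring_mult by blast+
  qed
qed

section \<open>Polynomials with coefficients in a subring, and ring adjunction\<close>

definition polys_over :: "'a::comm_ring_1 set \<Rightarrow> 'a poly set" where
  "polys_over V = {p. \<forall>i. coeff p i \<in> V}"

lemma polys_overI: "(\<And>i. coeff p i \<in> V) \<Longrightarrow> p \<in> polys_over V"
  and polys_overD: "p \<in> polys_over V \<Longrightarrow> coeff p i \<in> V"
  by (auto simp: polys_over_def)

lemma is_subring_polys_over:
  assumes "is_subring V"
  shows "is_subring (polys_over V)"
proof -
  have "coeff 1 i \<in> V" for i
    using assms by (simp add: coeff_1 subring_zero subring_one)
  moreover have "coeff (p * q) i \<in> V" if "p \<in> polys_over V" "q \<in> polys_over V" for p q i
    unfolding coeff_mult using assms that by (auto intro!: subring_intros polys_overD)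
  ultimately show ?thesis
    using assms unfolding is_subring_def[of "polys_over V"]
    by (auto simp: polys_over_def subring_add subring_uminus)
qed

lemma polys_over_pCons:
  "is_subring V \<Longrightarrow> a \<in> V \<Longrightarrow> p \<in> polys_over V \<Longrightarrow> pCons a p \<in> polys_over V"
  by (auto simp: polys_over_def coeff_pCons split: nat.splits)

lemma polys_over_monom: "is_subring V \<Longrightarrow> a \<in> V \<Longrightarrow> monom a n \<in> polys_over V"
  by (auto simp: polys_over_def subring_zero)

lemma polys_over_smult: "is_subring V \<Longrightarrow> a \<in> V \<Longrightarrow> p \<in> polys_over V \<Longrightarrow> smult a p \<in> polys_over V"
  by (auto simp: polys_over_def subring_mult)

lemma polys_over_mono: "V \<subseteq> W \<Longrightarrow> polys_over V \<subseteq> polys_over W"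
  by (auto simp: polys_over_def)

lemma poly_in_subring:
  assumes "is_subring V" "p \<in> polys_over V" "s \<in> V"
  shows "poly p s \<in> V"
  unfolding poly_altdef using assms by (auto intro!: subring_intros polys_overD)

definition adjoin :: "'a::comm_ring_1 set \<Rightarrow> 'a \<Rightarrow> 'a set" where
  "adjoin V s = (\<lambda>p. poly p s) ` polys_over V"

lemma is_subring_adjoin:
  assumes "is_subring V"
  shows "is_subring (adjoin V s)"
proof -
  note P = is_subring_polys_over[OF assms]
  show ?thesis
    unfolding is_subring_def adjoin_def
  proof (intro conjI ballI)
    show "1 \<in> (\<lambda>p. poly p s) ` polys_over V"
      using subring_one[OF P] by (intro image_eqI[of _ _ 1]) auto
    fix a assume "a \<in> (\<lambda>p. poly p s) ` polys_over V"
    then obtain p where p: "a = poly p s" "p \<in> polys_over V" by blast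
    show "- a \<in> (\<lambda>p. poly p s) ` polys_over V"
      using p subring_uminus[OF P] by (intro image_eqI[of _ _ "- p"]) auto
    fix b assume "b \<in> (\<lambda>p. poly p s) ` polys_over V"
    then obtain q where q: "b = poly q s" "q \<in> polys_over V" by blast
    show "a + b \<in> (\<lambda>p. poly p s) ` polys_over V"
      using p q subring_add[OF P] by (intro image_eqI[of _ _ "p + q"]) auto
    show "a * b \<in> (\<lambda>p. poly p s) ` polys_over V"
      using p q subring_mult[OF P] by (intro image_eqI[of _ _ "p * q"]) auto
  qed
qed

lemma adjoin_superset: "is_subring V \<Longrightarrow> V \<subseteq> adjoin V s"
  unfolding adjoin_def
  by (intro subsetI image_eqI[of _ _ "[:_:]"]) (auto intro: polys_over_pCons subring_zero[OF is_subring_polys_over])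

lemma adjoin_self: "is_subring V \<Longrightarrow> s \<in> adjoin V s"
  unfolding adjoin_def
  by (intro image_eqI[of _ _ "[:0, 1:]"])
     (auto intro!: polys_over_pCons subring_intros is_subring_polys_over)

lemma adjoin_least:
  assumes "is_subring W" "V \<subseteq> W" "s \<in> W"
  shows "adjoin V s \<subseteq> W"
  using assms polys_over_mono[OF assms(2)] by (auto simp: adjoin_def intro: poly_in_subring)

lemma exists_conching_subring:
  assumes xy: "x * y = 1" and R: "is_subring R" "y \<in> R" "x \<notin> R"
  obtains V where "R \<subseteq> V" "is_subring V" "y \<in> V" "x \<notin> V"
    "\<And>W. is_subring W \<Longrightarrow> x \<notin> W \<Longrightarrow> V \<subseteq> W \<Longrightarrow> W = V"
proof -
  let ?A = "{W. is_subring W \<and> R \<subseteq> W \<and> x \<notin> W}"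
  have "\<exists>M\<in>?A. \<forall>X\<in>?A. M \<subseteq> X \<longrightarrow> X = M"
  proof (rule subset_Zorn_nonempty)
    fix C assume C: "C \<noteq> {}" "subset.chain ?A C"
    then have "is_subring (\<Union>C)" by (intro subring_Union_chain) auto
    moreover have "C \<subseteq> ?A" using C by (simp add: subset_chain_def)
    then have "R \<subseteq> \<Union>C" "x \<notin> \<Union>C" using C(1) by blast+
    ultimately show "\<Union>C \<in> ?A" by blast
  qed (use R in blast)
  then obtain M where M: "M \<in> ?A" "\<forall>X\<in>?A. M \<subseteq> X \<longrightarrow> X = M" by (rule bexE)
  show ?thesis
  proof (rule that[of M])
    show M': "R \<subseteq> M" "is_subring M" "y \<in> M" "x \<notin> M" using M(1) R by auto
    show "W = M" if W: "is_subring W" "x \<notin> W" "M \<subseteq> W" for W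
    proof -
      have "W \<in> ?A" using W M'(1) by blast
      with M(2) W(3) show ?thesis by blast
    qed
  qed
qed

text \<open>If \<open>R[x]\<close> is the whole ring, then so is \<open>V[x]\<close> for every \<open>V\<close> above \<open>R\<close>; hence a subring
  above \<open>R\<close> that conches \<open>x\<close> is already a maximal subring.\<close>

lemma conch_maximal_subring_above:
  fixes R :: "'a::comm_ring_1 set"
  assumes xy: "x * y = 1" and R: "is_subring R" "y \<in> R" "x \<notin> R"
    and gen: "\<And>t. \<exists>n. y ^ n * t \<in> R"
  shows "\<exists>V::'a set. conch_maximal_subring V"
proof -
  obtain V where V: "R \<subseteq> V" "is_subring V" "y \<in> V" "x \<notin> V"
    "\<And>W. is_subring W \<Longrightarrow> x \<notin> W \<Longrightarrow> V \<subseteq> W \<Longrightarrow> W = V"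
    using exists_conching_subring[OF xy R] by blast
  have "W = V" if W: "is_subring W" "V \<subseteq> W" "W \<noteq> UNIV" for W
  proof (rule V(5)[OF W(1) _ W(2)])
    show "x \<notin> W"
    proof
      assume "x \<in> W"
      have "t \<in> W" for t
      proof -
        obtain n where "y ^ n * t \<in> W" using gen[of t] V(1) W(2) by blast
        then have "x ^ n * (y ^ n * t) \<in> W"
          using \<open>x \<in> W\<close> W(1) by (auto intro: subring_mult subring_power)
        also have "x ^ n * (y ^ n * t) = (x * y) ^ n * t" by (simp add: power_mult_distrib mult_ac)
        finally show ?thesis by (simp add: xy)
      qed
      with W(3) show False by blast
    qed
  qed
  then have "maximal_subring V" using V by (auto simp: maximal_subring_def)
  moreover have "conches V x" using V xy unfolding conches_def by blast
  moreover have "x dvd 1" using xy by (metis dvd_triv_left)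
  ultimately show ?thesis unfolding conch_maximal_subring_def by blast
qed

section \<open>Subrings of a field conching an element\<close>

lemma reverse_poly_over:
  fixes V :: "'k::field set"
  assumes "is_subring V" "p \<in> polys_over V" "degree p \<le> n" "s \<noteq> 0"
  obtains r where "r \<in> polys_over V" "degree r \<le> n" "s ^ n * poly p (inverse s) = poly r s"
proof
  \<comment> \<open>\<open>reflect_poly p\<close> corresponds to the exponent
    \<open>degree p\<close>; the monomial makes up the difference to \<open>n\<close>.\<close>
  let ?r = "monom 1 (n - degree p) * reflect_poly p"
  show "?r \<in> polys_over V"
    using assms
    by (intro subring_mult is_subring_polys_over polys_over_monom subring_one polys_overI)
       (auto simp: coeff_reflect_poly intro: subring_zero polys_overD)
  show "degree ?r \<le> n"
    using degree_mult_le[of "monom (1::'k) (n - degree p)" "reflect_poly p"]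
      degree_reflect_poly_le[of p] assms(3)
    by (simp add: degree_monom_eq)
  have "s ^ n = s ^ (n - degree p) * s ^ degree p"
    using assms(3) by (simp flip: power_add)
  then show "s ^ n * poly p (inverse s) = poly ?r s"
    using assms(4) by (simp add: poly_monom poly_reflect_poly_nz)
qed

text \<open>\<open>V\<close> is maximal among the subrings of the subfield \<open>S\<close> that avoid \<open>x\<close>. As in the classical
  theory of maximal pairs this makes \<open>V\<close> a valuation ring of \<open>S\<close>.\<close>

locale conch_in_subfield =
  fixes S V :: "'k::field set" and x y :: 'k
  assumes xy: "x * y = 1"
    and S: "is_subring S" "\<And>a. a \<in> S \<Longrightarrow> inverse a \<in> S"
    and V: "is_subring V" "V \<subseteq> S" "y \<in> V" "x \<notin> V"
    and maximal: "\<And>W. is_subring W \<Longrightarrow> V \<subseteq> W \<Longrightarrow> W \<subseteq> S \<Longrightarrow> x \<notin> W \<Longrightarrow> W = V"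
begin

text \<open>By maximality V[s], being strictly larger than V, contains x, say as p(s); multiplying
  by y gives the relation.\<close>

lemma x_poly_outside:
  assumes "s \<in> S" "s \<notin> V"
  obtains p where "p \<in> polys_over V" "y * poly p s = 1"
proof -
  have "x \<in> adjoin V s"
    using maximal[OF is_subring_adjoin[OF V(1)] adjoin_superset[OF V(1)], of s]
      adjoin_least[OF S(1) V(2)] adjoin_self[OF V(1)] assms by metis
  then show ?thesis
    using that xy by (auto simp: adjoin_def mult.commute)
qed

text \<open>This places y in the Jacobson radical of V. If u = 1 - y w had no inverse in V, a
  relation y p(1/u) = 1 multiplied by a power of u would put that power into y V. Powers of u are
  congruent to 1 modulo y V, so 1 would lie in y V and x in V.\<close>

lemma inverse_one_minus:
  assumes "w \<in> V"
  shows "1 - y * w \<noteq> 0" "inverse (1 - y * w) \<in> V"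
proof -
  let ?u = "1 - y * w"
  show nz: "?u \<noteq> 0"
  proof
    assume "?u = 0"
    then have "x * (y * w) = x" by simp
    then have "w = x" using xy by (simp add: mult.assoc[symmetric])
    with V assms show False by simp
  qed
  show "inverse ?u \<in> V"
  proof (rule ccontr)
    assume "inverse ?u \<notin> V"
    moreover have u: "?u \<in> V" using assms V by (intro subring_intros)
    ultimately obtain p where p: "p \<in> polys_over V" "y * poly p (inverse ?u) = 1"
      using x_poly_outside S V by blast
    obtain r where r: "r \<in> polys_over V"
      "?u ^ degree p * poly p (inverse ?u) = poly r ?u"
      using reverse_poly_over[OF V(1) p(1) order_refl nz] by blast
    have pow: "\<exists>v\<in>V. ?u ^ n = 1 - y * v" for n
    proof (induction n)
      case 0
      show ?case using V by (intro bexI[of _ 0]) (auto intro: subring_intros)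
    next
      case (Suc n)
      then obtain v where v: "v \<in> V" "?u ^ n = 1 - y * v" by blast
      show ?case
      proof (rule bexI)
        show "?u ^ Suc n = 1 - y * (w + v - y * w * v)"
          unfolding power_Suc v(2) by (simp add: algebra_simps)
        show "w + v - y * w * v \<in> V" using v assms V by (intro subring_intros)
      qed
    qed
    then obtain v where v: "v \<in> V" "?u ^ degree p = 1 - y * v" by blast
    have "1 - y * v = y * poly r ?u"
      using p(2) unfolding r(2)[symmetric] v(2)[symmetric] by (simp add: mult.left_commute)
    then have "1 = y * (v + poly r ?u)" by (simp add: algebra_simps)
    then have "x = (x * y) * (v + poly r ?u)" by (metis mult.assoc mult.right_neutral)
    then have "x = v + poly r ?u" by (simp add: xy)
    moreover have "v + poly r ?u \<in> V"
      using v u r V by (intro subring_add poly_in_subring)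
    ultimately show False using V by simp
  qed
qed

text \<open>Both relations express \<open>1\<close> by elements of \<open>y V[s]\<close> and of \<open>y V[1/s]\<close>; the relation of smaller
  degree lowers the degree of the other one.\<close>

lemma lower_degree:
  assumes s: "s \<noteq> 0" and p: "p \<in> polys_over V" "y * poly p s = 1"
    and q: "q \<in> polys_over V" "y * poly q (inverse s) = 1" and le: "degree q \<le> degree p"
  obtains p' where "p' \<in> polys_over V" "y * poly p' s = 1" "degree p' < degree p"
proof -
  obtain a q' where q': "q = pCons a q'" by (cases q)
  have a: "a \<in> V" and q'V: "q' \<in> polys_over V"
    using polys_overD[OF q(1), of 0] polys_overD[OF q(1), of "Suc _"]
    by (auto simp: q' intro!: polys_overI)
  define u where "u = 1 - y * a"
  have u: "u \<noteq> 0" "inverse u \<in> V" using inverse_one_minus[OF a] by (auto simp: u_def)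
  have u_eq: "u = y * (inverse s * poly q' (inverse s))"
    using q(2) by (simp add: q' u_def algebra_simps)
  with u(1) have "q' \<noteq> 0" by auto
  define m where "m = degree q'"
  have m: "Suc m \<le> degree p" using le \<open>q' \<noteq> 0\<close> by (simp add: q' m_def)
  obtain r where r: "r \<in> polys_over V" "degree r \<le> m" "s ^ m * poly q' (inverse s) = poly r s"
    using reverse_poly_over[OF V(1) q'V _ s] by (metis m_def order_refl)
  have "s ^ Suc m * u = y * poly r s"
    unfolding u_eq r(3)[symmetric] using s by simp
  \<comment> \<open>The relation in 1/s, solved for its unit constant part u and multiplied by a
    power of s, is a monic equation for s of degree \<open>Suc m\<close> over V.\<close>
  then have pow: "s ^ Suc m = inverse u * y * poly r s"
    using u(1) by (simp add: field_simps)
  define n where "n = degree p"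
  define c where "c = coeff p n"
  \<comment> \<open>At s the polynomial \<open>e\<close> takes the value of the leading term of
    \<open>p\<close>, but it has smaller degree; \<open>p'\<close> exchanges the two.\<close>
  define e where "e = monom (c * y * inverse u) (n - Suc m) * r"
  define p' where "p' = p - monom c n + e"
  have "s ^ n = s ^ (n - Suc m) * s ^ Suc m"
    using m unfolding power_add[symmetric] n_def by simp
  then have "poly e s = c * s ^ n"
    unfolding e_def by (simp add: poly_monom pow del: power_Suc)
  then have "poly p' s = poly p s"
    by (simp add: p'_def poly_monom)
  have degm: "degree e \<le> (n - Suc m) + m"
    unfolding e_def by (rule order.trans[OF degree_mult_le add_mono[OF degree_monom_le r(2)]])
  then have dege: "degree e < n" using m by (simp add: n_def)
  have "degree p' \<le> n"
    using dege unfolding p'_def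
    by (intro degree_add_le degree_diff_le degree_monom_le) (auto simp: n_def)
  moreover have "coeff p' n = 0"
    using coeff_eq_0[OF dege] by (simp add: p'_def c_def)
  ultimately have "degree p' < n"
    using eq_zero_or_degree_less[of p' n] m by (auto simp: n_def)
  show ?thesis
  proof
    show "p' \<in> polys_over V"
      unfolding p'_def e_def c_def using p(1) r(1) u V
      by (intro subring_add subring_diff subring_mult is_subring_polys_over polys_over_monom
          polys_overD) auto
    show "y * poly p' s = 1" using \<open>poly p' s = poly p s\<close> p(2) by simp
    show "degree p' < degree p" using \<open>degree p' < n\<close> by (simp add: n_def)
  qed
qed

lemma no_two_relations:
  assumes "s \<noteq> 0" "p \<in> polys_over V" "q \<in> polys_over V"
    and "y * poly p s = 1" "y * poly q (inverse s) = 1"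
  shows False
  using assms
proof (induction "degree p + degree q" arbitrary: p q s rule: less_induct)
  case less
  show False
  proof (cases "degree q \<le> degree p")
    case True
    with less.prems obtain p' where "p' \<in> polys_over V" "y * poly p' s = 1" "degree p' < degree p"
      using lower_degree by blast
    with less.hyps[of p' q s] less.prems show False by simp
  next
    case False
    with less.prems obtain q' where "q' \<in> polys_over V" "y * poly q' (inverse s) = 1" "degree q' < degree q"
      using lower_degree[of "inverse s" q p] by auto
    with less.hyps[of p q' s] less.prems show False by simp
  qed
qed

section \<open>The valuation ring V, its maximal ideal and Gauss's lemma\<close>

lemma valuation:
  assumes "s \<in> S"
  shows "s \<in> V \<or> inverse s \<in> V"
proof (rule ccontr)
  assume "\<not> (s \<in> V \<or> inverse s \<in> V)"
  moreover from this have "s \<noteq> 0" using subring_zero[OF V(1)] by auto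
  ultimately show False
    using x_poly_outside[of s] x_poly_outside[of "inverse s"] no_two_relations[of s] assms S(2)
    by metis
qed

text \<open>The maximal ideal of V. Since \<open>inverse 0 = 0\<close> lies in V, zero needs its own
  clause.\<close>

definition nonunits :: "'k set" where
  "nonunits = {a \<in> V. a = 0 \<or> inverse a \<notin> V}"

lemma nonunits_mult:
  assumes a: "a \<in> nonunits" and w: "w \<in> V"
  shows "a * w \<in> nonunits"
proof -
  have "inverse (a * w) \<notin> V" if "a * w \<noteq> 0"
  proof
    assume "inverse (a * w) \<in> V"
    then have "w * inverse (a * w) \<in> V" using w V by (intro subring_intros)
    moreover have "w * inverse (a * w) = inverse a" using that by (simp add: field_simps)
    ultimately have "inverse a \<in> V" by (simp only:)
    then show False using a that by (auto simp: nonunits_def)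
  qed
  then show ?thesis using a w V by (auto simp: nonunits_def intro: subring_mult)
qed

text \<open>One of a/b and b/a lies in V, so a + b is a multiple in V of b or of a.\<close>

lemma nonunits_add:
  assumes ab: "a \<in> nonunits" "b \<in> nonunits"
  shows "a + b \<in> nonunits"
proof (cases "a = 0 \<or> b = 0")
  case True
  with ab show ?thesis by auto
next
  case False
  have "a \<in> S" "b \<in> S" using ab V by (auto simp: nonunits_def)
  then have "a * inverse b \<in> V \<or> inverse (a * inverse b) \<in> V"
    using S by (intro valuation subring_mult) auto
  then have "(1 + a * inverse b) \<in> V \<or> (1 + inverse a * b) \<in> V"
    using V by (auto intro: subring_intros simp: mult.commute)
  then have "b * (1 + a * inverse b) \<in> nonunits \<or> a * (1 + inverse a * b) \<in> nonunits"
    using ab nonunits_mult by blast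
  then show ?thesis using False by (simp add: field_simps)
qed

lemma nonunits_sum: "(\<And>i. i \<in> I \<Longrightarrow> f i \<in> nonunits) \<Longrightarrow> sum f I \<in> nonunits"
proof -
  have "0 \<in> nonunits" by (simp add: nonunits_def subring_zero[OF V(1)])
  then show "(\<And>i. i \<in> I \<Longrightarrow> f i \<in> nonunits) \<Longrightarrow> sum f I \<in> nonunits"
    by (induction I rule: infinite_finite_induct) (auto intro: nonunits_add)
qed

lemma nonunits_prime:
  assumes "a \<in> V" "a \<notin> nonunits" "b \<in> V" "b \<notin> nonunits"
  shows "a * b \<notin> nonunits"
  using assms V(1) by (auto simp: nonunits_def intro: subring_mult)

text \<open>Polynomials with a unit among their coefficients, that is, of Gauss value zero.\<close>

definition primitive :: "'k poly set" where
  "primitive = {f \<in> polys_over V. \<exists>i. coeff f i \<notin> nonunits}"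

text \<open>Gauss's lemma. With i and j the least indices of unit coefficients, the coefficient of
  the product at i + j is a unit plus terms each having a nonunit factor.\<close>

lemma primitive_mult:
  assumes f: "f \<in> primitive" and g: "g \<in> primitive"
  shows "f * g \<in> primitive"
proof -
  define i where "i = (LEAST i. coeff f i \<notin> nonunits)"
  define j where "j = (LEAST j. coeff g j \<notin> nonunits)"
  have i: "coeff f i \<notin> nonunits" "\<And>k. k < i \<Longrightarrow> coeff f k \<in> nonunits"
    using f LeastI_ex[of "\<lambda>k. coeff f k \<notin> nonunits"]
    unfolding i_def primitive_def by (auto dest: not_less_Least)
  have j: "coeff g j \<notin> nonunits" "\<And>k. k < j \<Longrightarrow> coeff g k \<in> nonunits"
    using g LeastI_ex[of "\<lambda>k. coeff g k \<notin> nonunits"]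
    unfolding j_def primitive_def by (auto dest: not_less_Least)
  have V': "coeff f k \<in> V" "coeff g k \<in> V" for k
    using f g by (auto simp: primitive_def polys_over_def)
  let ?s = "\<Sum>k\<in>{..i + j} - {i}. coeff f k * coeff g (i + j - k)"
  have "?s \<in> nonunits"
  proof (rule nonunits_sum)
    fix k assume k: "k \<in> {..i + j} - {i}"
    then consider "k < i" | "i + j - k < j" by fastforce
    then show "coeff f k * coeff g (i + j - k) \<in> nonunits"
      using nonunits_mult[OF i(2) V'(2)] nonunits_mult[OF j(2) V'(1)]
      by cases (auto simp: mult.commute)
  qed
  moreover have "coeff (f * g) (i + j) = coeff f i * coeff g j + ?s"
    unfolding coeff_mult by (subst sum.remove[of _ i]) auto
  ultimately have "coeff (f * g) (i + j) \<notin> nonunits"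
    using nonunits_add[OF _ nonunits_mult[OF \<open>?s \<in> nonunits\<close>, of "-1"], of "coeff (f * g) (i + j)"]
      nonunits_prime[of "coeff f i" "coeff g j"] i(1) j(1) V' V(1)
    by (auto intro: subring_intros)
  moreover have "f * g \<in> polys_over V"
    using f g V(1) by (auto simp: primitive_def intro: subring_mult is_subring_polys_over)
  ultimately show ?thesis by (auto simp: primitive_def)
qed

text \<open>Divisibility is total in a valuation ring, so a finite set has an element of least
  value, which divides all the others.\<close>

lemma common_divisor:
  assumes "finite A" "A \<noteq> {}" "A \<subseteq> V - {0}"
  shows "\<exists>c\<in>A. \<forall>d\<in>A. d * inverse c \<in> V"
  using assms
proof (induction A rule: finite_ne_induct)
  case (singleton a)
  then show ?case using subring_one[OF V(1)] by auto
next
  case (insert a A)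
  then obtain c where c: "c \<in> A" "\<And>d. d \<in> A \<Longrightarrow> d * inverse c \<in> V" by auto
  have nz: "a \<noteq> 0" "c \<noteq> 0" using insert.prems c by auto
  have "a \<in> S" "c \<in> S" using insert.prems c V by auto
  then have "a * inverse c \<in> V \<or> inverse (a * inverse c) \<in> V"
    using S by (intro valuation subring_mult) auto
  then show ?case
  proof
    assume "a * inverse c \<in> V"
    with c show ?thesis by auto
  next
    assume "inverse (a * inverse c) \<in> V"
    then have ca: "c * inverse a \<in> V" by (simp add: mult.commute)
    have "d * inverse a \<in> V" if "d \<in> A" for d
    proof -
      have "(d * inverse c) * (c * inverse a) \<in> V"
        using subring_mult[OF V(1) c(2)[OF that] ca] .
      also have "(d * inverse c) * (c * inverse a) = d * inverse a" using nz by simp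
      finally show ?thesis .
    qed
    then show ?thesis using nz subring_one[OF V(1)] by auto
  qed
qed

text \<open>Dividing by a nonzero coefficient of least value keeps all coefficients in V and turns
  that one into 1.\<close>

lemma content_primitive:
  assumes f: "f \<in> polys_over V" "f \<noteq> 0"
  obtains c g where "c \<in> V" "c \<noteq> 0" "g \<in> primitive" "f = smult c g"
proof -
  let ?A = "coeff f ` {..degree f} - {0}"
  have "lead_coeff f \<in> ?A" using f by auto
  then have "?A \<noteq> {}" by blast
  moreover have "?A \<subseteq> V - {0}" using f by (auto simp: polys_over_def)
  ultimately obtain c where c: "c \<in> ?A" "\<And>d. d \<in> ?A \<Longrightarrow> d * inverse c \<in> V"
    using common_divisor[of ?A] by auto
  then have nz: "c \<noteq> 0" by auto
  obtain i where i: "c = coeff f i" using c by auto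
  let ?g = "smult (inverse c) f"
  have "coeff ?g k \<in> V" for k
    using c(2)[of "coeff f k"] subring_zero[OF V(1)] coeff_eq_0[of f k]
    by (cases "coeff f k = 0"; cases "k \<le> degree f") (auto simp: mult.commute)
  moreover have "coeff ?g i \<notin> nonunits"
    using nz i subring_one[OF V(1)] by (auto simp: nonunits_def)
  ultimately have "?g \<in> primitive" unfolding primitive_def polys_over_def by blast
  moreover have "f = smult c ?g" using nz by simp
  moreover have "c \<in> V" using c(1) f by (auto simp: polys_over_def)
  ultimately show ?thesis using that nz by blast
qed

end

text \<open>For \<open>y\<close> invertible with \<open>1/y \<notin> W\<close> the last clause says that \<open>W[1/y]\<close> is a field. It makes
  \<open>y\<close> behave as an element of positive value for a valuation of rank one.\<close>

definition archimedean_subring :: "'k::field \<Rightarrow> 'k set \<Rightarrow> bool" where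
  "archimedean_subring y W \<longleftrightarrow> is_subring W \<and> y \<in> W \<and> inverse y \<notin> W \<and>
     (\<forall>a\<in>W. a \<noteq> 0 \<longrightarrow> (\<exists>b\<in>W. \<exists>k. a * b = y ^ k))"

lemma archimedean_subringD:
  assumes "archimedean_subring y W"
  shows "is_subring W" "y \<in> W" "inverse y \<notin> W" "y \<noteq> 0"
    and "\<And>a. a \<in> W \<Longrightarrow> a \<noteq> 0 \<Longrightarrow> \<exists>b\<in>W. \<exists>k. a * b = y ^ k"
  using assms by (auto simp: archimedean_subring_def)

section \<open>Inverting y, and maximal archimedean subrings\<close>

definition localization_away :: "'k::field \<Rightarrow> 'k set \<Rightarrow> 'k set" where
  "localization_away y W = {a. \<exists>n. y ^ n * a \<in> W}"

lemma localization_away_subfield: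
  assumes W: "archimedean_subring y W"
  shows "is_subring (localization_away y W)"
    and "a \<in> localization_away y W \<Longrightarrow> inverse a \<in> localization_away y W"
    and "W \<subseteq> localization_away y W"
proof -
  note W' = archimedean_subringD[OF W]
  let ?S = "localization_away y W"
  show WS: "W \<subseteq> ?S"
    unfolding localization_away_def by (auto intro: exI[of _ 0])
  show "is_subring ?S"
    unfolding is_subring_def
  proof (intro conjI ballI)
    show "1 \<in> ?S" using WS W' subring_one by blast
    fix a assume "a \<in> ?S"
    then obtain m where m: "y ^ m * a \<in> W" by (auto simp: localization_away_def)
    have "y ^ m * (- a) \<in> W" using subring_uminus[OF W'(1) m] by simp
    then show "- a \<in> ?S" unfolding localization_away_def by blast
    fix b assume "b \<in> ?S"
    then obtain n where n: "y ^ n * b \<in> W" by (auto simp: localization_away_def)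
    have "y ^ n * (y ^ m * a) + y ^ m * (y ^ n * b) \<in> W"
      using m n W' by (simp add: subring_add subring_mult subring_power)
    then have "y ^ (m + n) * (a + b) \<in> W" by (simp add: power_add algebra_simps)
    then show "a + b \<in> ?S" unfolding localization_away_def by blast
    have "(y ^ m * a) * (y ^ n * b) \<in> W" using m n W' by (simp add: subring_mult)
    then have "y ^ (m + n) * (a * b) \<in> W" by (simp add: power_add algebra_simps)
    then show "a * b \<in> ?S" unfolding localization_away_def by blast
  qed
  show "inverse a \<in> ?S" if "a \<in> ?S"
  proof (cases "a = 0")
    case False
    from that obtain m where m: "y ^ m * a \<in> W" by (auto simp: localization_away_def)
    then obtain b k where b: "b \<in> W" "y ^ m * a * b = y ^ k"
      using W'(5)[OF m] W'(4) False by auto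
    then have "y ^ k * inverse a = y ^ m * b" using False by (simp add: field_simps)
    then have "y ^ k * inverse a \<in> W" using W' b by (simp add: subring_mult subring_power)
    then show ?thesis unfolding localization_away_def by blast
  qed (use that in simp)
qed

text \<open>Turns maximality among archimedean subrings into maximality among all subrings of the
  field W[1/y] that avoid 1/y, as \<open>conch_in_subfield\<close> requires.\<close>

lemma archimedean_subring_intermediate:
  assumes W: "archimedean_subring y W" and U: "is_subring U" "W \<subseteq> U"
    "U \<subseteq> localization_away y W" "inverse y \<notin> U"
  shows "archimedean_subring y U"
proof -
  note W' = archimedean_subringD[OF W]
  have "\<exists>b\<in>U. \<exists>k. a * b = y ^ k" if a: "a \<in> U" "a \<noteq> 0" for a
  proof -
    obtain m where m: "y ^ m * a \<in> W" using a U by (auto simp: localization_away_def)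
    then obtain b k where b: "b \<in> W" "y ^ m * a * b = y ^ k"
      using W'(5)[OF m] W'(4) a by auto
    have "y ^ m * b \<in> U" using b W' U by (blast intro: subring_mult subring_power)
    moreover have "a * (y ^ m * b) = y ^ k" using b by (simp add: mult_ac)
    ultimately show ?thesis by blast
  qed
  then show ?thesis using W' U unfolding archimedean_subring_def by blast
qed

lemma exists_maximal_archimedean_subring:
  assumes "archimedean_subring y W0"
  obtains W where "archimedean_subring y W"
    "\<And>U. archimedean_subring y U \<Longrightarrow> W \<subseteq> U \<Longrightarrow> U = W"
proof -
  let ?A = "{W. archimedean_subring y W}"
  have "\<exists>M\<in>?A. \<forall>X\<in>?A. M \<subseteq> X \<longrightarrow> X = M"
  proof (rule subset_Zorn_nonempty)
    show "?A \<noteq> {}" using assms by blast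
    fix C assume C: "C \<noteq> {}" "subset.chain ?A C"
    have sub: "is_subring (\<Union>C)"
      using C by (intro subring_Union_chain[of ?A]) (auto simp: archimedean_subring_def)
    have CA: "archimedean_subring y W" if "W \<in> C" for W
      using C(2) that by (auto simp: subset_chain_def)
    have "\<exists>b\<in>\<Union>C. \<exists>k. a * b = y ^ k" if "a \<in> \<Union>C" "a \<noteq> 0" for a
      using that archimedean_subringD(5)[OF CA] by blast
    moreover have "y \<in> \<Union>C" "inverse y \<notin> \<Union>C"
      using C(1) archimedean_subringD(2,3)[OF CA] by blast+
    ultimately show "\<Union>C \<in> ?A" using sub by (simp add: archimedean_subring_def)
  qed
  then obtain M where M: "M \<in> ?A" "\<forall>X\<in>?A. M \<subseteq> X \<longrightarrow> X = M" by (rule bexE)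
  then show ?thesis by (intro that[of M]) simp_all
qed

text \<open>For t transcendental over V this is the valuation ring of the Gauss extension, in which
  a polynomial has the least value of its coefficients. Denominators are normalized to value zero;
  they are closed under products by \<open>primitive_mult\<close>.\<close>

definition (in conch_in_subfield) gauss_extension :: "'k \<Rightarrow> 'k set" where
  "gauss_extension t = {poly f t / poly g t | f g. f \<in> polys_over V \<and> g \<in> primitive}"

context conch_in_subfield
begin

lemma primitive_nonzero: "g \<in> primitive \<Longrightarrow> g \<noteq> 0"
  by (auto simp: primitive_def nonunits_def subring_zero[OF V(1)])

lemma primitive_over: "g \<in> primitive \<Longrightarrow> g \<in> polys_over V"
  by (simp add: primitive_def)

lemma one_primitive: "1 \<in> primitive"
proof -
  have "coeff 1 0 \<notin> nonunits" using V(1) by (simp add: nonunits_def subring_one)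
  then show ?thesis
    using subring_one[OF is_subring_polys_over[OF V(1)]] unfolding primitive_def by blast
qed

context
  fixes t
  assumes transcendental: "\<And>f. f \<in> polys_over V \<Longrightarrow> f \<noteq> 0 \<Longrightarrow> poly f t \<noteq> 0"
begin

lemma gauss_extensionI:
  "f \<in> polys_over V \<Longrightarrow> g \<in> primitive \<Longrightarrow> poly f t / poly g t \<in> gauss_extension t"
  by (auto simp: gauss_extension_def)

lemma poly_in_gauss_extension: "f \<in> polys_over V \<Longrightarrow> poly f t \<in> gauss_extension t"
  using gauss_extensionI[OF _ one_primitive] by simp

lemma poly_primitive_nonzero: "g \<in> primitive \<Longrightarrow> poly g t \<noteq> 0"
  using transcendental primitive_over primitive_nonzero by blast

lemma is_subring_gauss_extension: "is_subring (gauss_extension t)"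
  unfolding is_subring_def
proof (intro conjI ballI)
  note P = is_subring_polys_over[OF V(1)]
  show "1 \<in> gauss_extension t"
    using poly_in_gauss_extension[OF subring_one[OF P]] by simp
  fix a assume "a \<in> gauss_extension t"
  then obtain f g where a: "a = poly f t / poly g t" "f \<in> polys_over V" "g \<in> primitive"
    by (auto simp: gauss_extension_def)
  show "- a \<in> gauss_extension t"
    using gauss_extensionI[OF subring_uminus[OF P a(2)] a(3)] by (simp add: a(1))
  fix b assume "b \<in> gauss_extension t"
  then obtain f' g' where b: "b = poly f' t / poly g' t" "f' \<in> polys_over V" "g' \<in> primitive"
    by (auto simp: gauss_extension_def)
  note nz = poly_primitive_nonzero[OF a(3)] poly_primitive_nonzero[OF b(3)]
  have "f * g' + f' * g \<in> polys_over V"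
    using a b P by (simp add: subring_add subring_mult primitive_over)
  from gauss_extensionI[OF this primitive_mult[OF a(3) b(3)]]
  show "a + b \<in> gauss_extension t" using nz by (simp add: a(1) b(1) add_frac_eq)
  show "a * b \<in> gauss_extension t"
    using gauss_extensionI[OF subring_mult[OF P a(2) b(2)] primitive_mult[OF a(3) b(3)]]
    by (simp add: a(1) b(1))
qed

text \<open>If 1/y = f(t)/g(t), transcendence gives g = y f as polynomials. A unit coefficient of g
  then makes y a unit of V, against the choice of x.\<close>

lemma inverse_notin_gauss_extension: "inverse y \<notin> gauss_extension t"
proof
  have nz: "y \<noteq> 0" using xy by auto
  assume "inverse y \<in> gauss_extension t"
  then obtain f g where fg: "inverse y = poly f t / poly g t" "f \<in> polys_over V" "g \<in> primitive"
    by (auto simp: gauss_extension_def)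
  have "poly (g - smult y f) t = 0"
    using fg(1) nz poly_primitive_nonzero[OF fg(3)] by (simp add: field_simps)
  moreover have "g - smult y f \<in> polys_over V"
    using fg V by (simp add: subring_diff is_subring_polys_over polys_over_smult primitive_over)
  ultimately have "g = smult y f" using transcendental by force
  moreover obtain i where i: "coeff g i \<notin> nonunits" using fg(3) by (auto simp: primitive_def)
  ultimately have "inverse (y * coeff f i) \<in> V" "y * coeff f i \<noteq> 0"
    using polys_overD[OF primitive_over[OF fg(3)], of i] by (auto simp: nonunits_def)
  then have "coeff f i * inverse (y * coeff f i) \<in> V"
    using polys_overD[OF fg(2)] V(1) by (simp add: subring_mult del: inverse_mult_distrib)
  moreover have "coeff f i * inverse (y * coeff f i) = x"
    using \<open>y * coeff f i \<noteq> 0\<close> xy by (simp add: field_simps)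
  ultimately show False using V(4) by simp
qed

text \<open>Writing the numerator as c h with h primitive makes h(t)/g(t) a unit, so only the
  constant c has to divide a power of y, and it does so already in V.\<close>

lemma archimedean_gauss_extension:
  assumes W: "archimedean_subring y V"
  shows "archimedean_subring y (gauss_extension t)"
proof -
  note P = is_subring_polys_over[OF V(1)]
  have const: "c \<in> gauss_extension t" if "c \<in> V" for c
    using poly_in_gauss_extension[of "[:c:]"] that V(1) subring_zero[OF P]
    by (simp add: polys_over_pCons)
  have "\<exists>b\<in>gauss_extension t. \<exists>k. a * b = y ^ k" if a_in: "a \<in> gauss_extension t" "a \<noteq> 0" for a
  proof -
    obtain f g where a: "a = poly f t / poly g t" "f \<in> polys_over V" "g \<in> primitive"
      using a_in(1) by (auto simp: gauss_extension_def)
    with a_in(2) have "f \<noteq> 0" by auto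
    then obtain c h where h: "c \<in> V" "c \<noteq> 0" "h \<in> primitive" "f = smult c h"
      using content_primitive a(2) by blast
    obtain b k where b: "b \<in> V" "c * b = y ^ k"
      using archimedean_subringD(5)[OF W h(1,2)] by blast
    have "b * (poly g t / poly h t) \<in> gauss_extension t"
      using const[OF b(1)] gauss_extensionI[OF primitive_over[OF a(3)] h(3)]
        is_subring_gauss_extension subring_mult by blast
    moreover have "a * (b * (poly g t / poly h t)) = y ^ k"
      unfolding b(2)[symmetric] using poly_primitive_nonzero[OF h(3)] poly_primitive_nonzero[OF a(3)]
      by (simp add: a(1) h(4))
    ultimately show ?thesis by blast
  qed
  then show ?thesis
    using is_subring_gauss_extension inverse_notin_gauss_extension const[OF V(3)]
    by (simp add: archimedean_subring_def)
qed

end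

end

text \<open>A maximal archimedean subring is a valuation ring of its fraction field, so by the Gauss
  extension every \<open>t\<close> is algebraic over it. Then every \<open>t\<close> becomes integral after multiplication by
  a power of \<open>y\<close>, and integral elements lie in every valuation ring above.\<close>

lemma power_multiple_in_subring:
  fixes x y :: "'k::field"
  assumes xy: "x * y = 1" and W0: "archimedean_subring y W0"
  obtains V where "is_subring V" "y \<in> V" "x \<notin> V" "\<And>t. \<exists>n. y ^ n * t \<in> V"
proof -
  have x: "x = inverse y" using xy by (metis inverse_unique mult.commute)
  obtain W where W: "archimedean_subring y W"
    and max: "\<And>U. archimedean_subring y U \<Longrightarrow> W \<subseteq> U \<Longrightarrow> U = W"
    using exists_maximal_archimedean_subring[OF W0] by blast
  note W' = archimedean_subringD[OF W]
  interpret W: conch_in_subfield "localization_away y W" W x y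
  proof
    show "U = W" if "is_subring U" "W \<subseteq> U" "U \<subseteq> localization_away y W" "x \<notin> U" for U
      using max[OF archimedean_subring_intermediate[OF W that(1-3)]] that x by blast
  qed (use W' x xy localization_away_subfield[OF W] in auto)
  have algebraic: "\<exists>f\<in>polys_over W. f \<noteq> 0 \<and> poly f t = 0" for t
  proof (rule ccontr)
    assume "\<not> ?thesis"
    then have tr: "\<And>f. f \<in> polys_over W \<Longrightarrow> f \<noteq> 0 \<Longrightarrow> poly f t \<noteq> 0" by blast
    have const: "[:c:] \<in> polys_over W" if "c \<in> W" for c
      using that W'(1) by (simp add: polys_over_pCons subring_zero is_subring_polys_over)
    have "W \<subseteq> W.gauss_extension t"
      using W.poly_in_gauss_extension[OF tr const] by auto
    \<comment> \<open>The Gauss extension cannot enlarge a maximal W, so t would lie in W and be a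
      root of X - t over W.\<close>
    then have "W.gauss_extension t = W"
      using max[OF W.archimedean_gauss_extension[OF tr W]] by blast
    moreover have X: "[:0, 1:] \<in> polys_over W"
      using W'(1) by (intro polys_over_pCons const) (auto intro: subring_zero subring_one)
    ultimately have "t \<in> W" using W.poly_in_gauss_extension[OF tr X] by simp
    then have "[:- t, 1:] \<in> polys_over W"
      using W'(1) by (intro polys_over_pCons const) (auto intro: subring_uminus subring_one)
    from tr[OF this] show False by simp
  qed
  obtain V where V: "W \<subseteq> V" "is_subring V" "y \<in> V" "x \<notin> V"
    "\<And>U. is_subring U \<Longrightarrow> x \<notin> U \<Longrightarrow> V \<subseteq> U \<Longrightarrow> U = V"
    using exists_conching_subring[OF xy W'(1,2)] W'(3) x by metis
  \<comment> \<open>With the whole field as ambient subfield the same locale shows that V is a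
    valuation ring of it, so 1/t is in V whenever t is not.\<close>
  interpret V: conch_in_subfield UNIV V x y
    using V xy by unfold_locales (auto simp: is_subring_def)
  have "\<exists>n. y ^ n * t \<in> V" for t
  proof (cases "t \<in> V")
    case True
    then show ?thesis by (auto intro: exI[of _ 0])
  next
    case False
    then have inv: "inverse t \<in> V" and t: "t \<noteq> 0"
      using V.valuation[of t] subring_zero[OF V(2)] by auto
    obtain f where f: "f \<in> polys_over W" "f \<noteq> 0" "poly f t = 0" using algebraic by blast
    obtain b k where b: "b \<in> W" "lead_coeff f * b = y ^ k"
      using W'(5)[of "lead_coeff f"] f polys_overD[OF f(1)] by auto
    define d where "d = degree f"
    have "d \<noteq> 0"
    proof
      assume "d = 0"
      then obtain c where "f = [:c:]" unfolding d_def by (auto elim: degree_eq_zeroE)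
      with f show False by simp
    qed
    \<comment> \<open>The factor b makes the leading coefficient of the relation
      \<open>y ^ k\<close>, and \<open>h\<close> is the rest, so h(t) = - y^k t^d. Dividing by t^(d
      - 1) leaves one factor t on the right and turns the left side into a polynomial in 1/t, which
      lies in V.\<close>
    define h where "h = smult b f - monom (y ^ k) d"
    have h: "h \<in> polys_over V"
      unfolding h_def using f b V polys_over_mono[OF V(1)]
      by (blast intro: subring_diff is_subring_polys_over polys_over_smult polys_over_monom subring_power)
    have "degree h \<le> d"
      unfolding h_def d_def by (intro degree_diff_le degree_monom_le degree_smult_le)
    moreover have "coeff h d = 0"
      using b(2) by (simp add: h_def d_def mult.commute)
    ultimately have "degree h \<le> d - 1"
      using eq_zero_or_degree_less[of h d] \<open>d \<noteq> 0\<close> by auto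
    then obtain r where r: "r \<in> polys_over V"
      "inverse t ^ (d - 1) * poly h (inverse (inverse t)) = poly r (inverse t)"
      using reverse_poly_over[OF V(2) h, of "d - 1" "inverse t"] t by auto
    have "poly h t = - (y ^ k * t ^ d)" using f(3) by (simp add: h_def poly_monom)
    moreover have "t ^ d = t * t ^ (d - 1)" using \<open>d \<noteq> 0\<close> by (simp flip: power_Suc)
    ultimately have "poly r (inverse t) = - (y ^ k * t)"
      using r(2) t by (simp add: field_simps)
    then have "y ^ k * t = - poly r (inverse t)" by simp
    also have "\<dots> \<in> V" using r(1) inv V(2) by (blast intro: subring_uminus poly_in_subring)
    finally show ?thesis by blast
  qed
  with V that show ?thesis by blast
qed

section \<open>An archimedean subring containing a given element\<close>

definition int_eval :: "int poly \<Rightarrow> 'a::comm_ring_1 \<Rightarrow> 'a" where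
  "int_eval f a = horner_sum of_int a (coeffs f)"

lemma int_eval_0 [simp]: "int_eval 0 a = 0"
  by (simp add: int_eval_def)

lemma int_eval_pCons [simp]: "int_eval (pCons c f) a = of_int c + a * int_eval f a"
  by (cases "c = 0 \<and> f = 0") (auto simp: int_eval_def cCons_def)

lemma int_eval_add [simp]: "int_eval (f + g) a = int_eval f a + int_eval g a"
  by (induction f g rule: poly_induct2) (simp_all add: algebra_simps)

lemma int_eval_smult [simp]: "int_eval (smult c f) a = of_int c * int_eval f a"
  by (induction f) (simp_all add: algebra_simps)

lemma int_eval_mult [simp]: "int_eval (f * g) a = int_eval f a * int_eval g a"
  by (induction f) (simp_all add: algebra_simps)

lemma int_eval_uminus [simp]: "int_eval (- f) a = - int_eval f a"
  using int_eval_smult[of "-1" f a] by simp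

lemma int_eval_diff [simp]: "int_eval (f - g) a = int_eval f a - int_eval g a"
  using int_eval_add[of f "- g" a] by simp

lemma int_eval_1 [simp]: "int_eval 1 a = 1"
  by (simp add: one_pCons)

lemma int_eval_monom [simp]: "int_eval (monom c n) a = of_int c * a ^ n"
  by (induction n) (simp_all add: monom_0 monom_Suc algebra_simps)

lemma int_eval_in_subring:
  assumes "is_subring S" "a \<in> S"
  shows "int_eval f a \<in> S"
  using assms by (induction f) (simp_all add: subring_zero subring_add subring_mult subring_of_int)

text \<open>Modulo q the polynomial is nonzero, hence a power of X times a polynomial with nonzero
  constant term. The value of the latter will be a unit of \<open>local_subring\<close>.\<close>

lemma split_off_residual_part:
  fixes q :: int
  assumes "\<not> (\<forall>i. q dvd coeff f i)"
  shows "\<exists>k g r. f = monom 1 k * g + smult q r \<and> \<not> q dvd coeff g 0"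
  using assms
proof (induction f)
  case (pCons a f)
  show ?case
  proof (cases "q dvd a")
    case False
    then show ?thesis
      by (intro exI[of _ 0] exI[of _ "pCons a f"]) (simp add: monom_0)
  next
    case True
    then obtain b where b: "a = q * b" by blast
    have "\<not> (\<forall>i. q dvd coeff f i)"
    proof
      assume "\<forall>i. q dvd coeff f i"
      with True have "q dvd coeff (pCons a f) i" for i by (cases i) simp_all
      with pCons.prems show False by blast
    qed
    then obtain k g r where g: "f = monom 1 k * g + smult q r" "\<not> q dvd coeff g 0"
      using pCons.IH by blast
    have "pCons a f = monom 1 (Suc k) * g + smult q (pCons b r)"
      unfolding g(1) b by (simp add: monom_Suc)
    with g(2) show ?thesis by blast
  qed
qed simp

text \<open>Euclid's algorithm on f and a relation g of least degree, with pseudo-division because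
  the coefficients are integers. A nonvanishing remainder has smaller degree than f, and its value
  is a multiple of f(y) in Z[y], so a multiplier for it yields one for f.\<close>

lemma int_eval_dvd_of_int:
  fixes y :: "'k::field"
  assumes char0: "\<And>n::int. of_int n = (0::'k) \<Longrightarrow> n = 0"
    and algebraic: "\<exists>g. g \<noteq> 0 \<and> int_eval g y = 0" and f: "int_eval f y \<noteq> 0"
  shows "\<exists>h n. n \<noteq> 0 \<and> int_eval f y * int_eval h y = of_int n"
proof -
  obtain g where g: "g \<noteq> 0" "int_eval g y = 0"
    and g_min: "\<And>h. h \<noteq> 0 \<Longrightarrow> int_eval h y = 0 \<Longrightarrow> degree g \<le> degree h"
    using exists_least_iff[of "\<lambda>d. \<exists>g. g \<noteq> 0 \<and> int_eval g y = 0 \<and> degree g = d"] algebraic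
    by (metis not_less)
  show ?thesis
    using f
  proof (induction "degree f" arbitrary: f rule: less_induct)
    case less
    have "f \<noteq> 0" using less.prems by auto
    show ?case
    proof (cases "degree g \<le> degree f")
      case True
      obtain a s where as: "a \<noteq> 0" "smult a f = g * s + pseudo_mod f g"
        using pseudo_mod(1)[OF g(1), of f] by blast
      define r where "r = pseudo_mod f g"
      have "int_eval (smult a f) y = int_eval (g * s + r) y" using as by (simp add: r_def)
      then have r: "int_eval r y = of_int a * int_eval f y" using g by simp
      then have "int_eval r y \<noteq> 0" using char0 as less.prems by auto
      moreover from this have "degree r < degree f"
        using pseudo_mod(2)[OF g(1), of f] True by (auto simp: r_def)
      ultimately obtain h n where h: "n \<noteq> 0" "int_eval r y * int_eval h y = of_int n"
        using less.hyps by blast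
      then have "int_eval f y * int_eval (smult a h) y = of_int n" by (simp add: r mult_ac)
      with h show ?thesis by blast
    next
      case False
      obtain a s where as: "a \<noteq> 0" "smult a g = f * s + pseudo_mod g f"
        using pseudo_mod(1)[OF \<open>f \<noteq> 0\<close>, of g] by blast
      define r where "r = pseudo_mod g f"
      have deg: "r = 0 \<or> degree r < degree f"
        using pseudo_mod(2)[OF \<open>f \<noteq> 0\<close>, of g] by (simp add: r_def)
      have "int_eval (smult a g) y = int_eval (f * s + r) y" using as by (simp add: r_def)
      then have r: "int_eval r y = - (int_eval f y * int_eval s y)"
        using g by (simp add: eq_neg_iff_add_eq_0 add.commute)
      show ?thesis
      proof (cases "int_eval r y = 0")
        case True
        \<comment> \<open>The remainder vanishes at y in degree below that of g, so it is zero; then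
          the cofactor s is itself a relation, and comparing degrees forces f to be
          constant.\<close>
        then have "r = 0" using deg False g_min by force
        then have gs: "smult a g = f * s" using as by (simp add: r_def)
        then have "s \<noteq> 0" using as g by auto
        moreover have "int_eval s y = 0" using r True less.prems by simp
        ultimately have "degree g \<le> degree s" using g_min by blast
        moreover have "degree g = degree f + degree s"
          using degree_mult_eq[OF \<open>f \<noteq> 0\<close> \<open>s \<noteq> 0\<close>] as gs degree_smult_eq[of a g] by simp
        ultimately have "degree f = 0" by simp
        then obtain c where "f = [:c:]" by (rule degree_eq_zeroE)
        with less.prems show ?thesis
          by (intro exI[of _ 1] exI[of _ c]) auto
      next
        case False
        then have "degree r < degree f" using deg by auto
        then obtain h n where h: "n \<noteq> 0" "int_eval r y * int_eval h y = of_int n"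
          using less.hyps False by blast
        then have "int_eval f y * int_eval (- (s * h)) y = of_int n" by (simp add: r mult_ac)
        with h show ?thesis by blast
      qed
    qed
  qed
qed

text \<open>The localization of the subring generated by \<open>y\<close> at the ideal \<open>(q, y)\<close>, where \<open>q\<close> is a prime
  number or \<open>0\<close>.\<close>

definition local_subring :: "int \<Rightarrow> 'k::field \<Rightarrow> 'k set" where
  "local_subring q y = {int_eval f y / int_eval g y | f g. \<not> q dvd coeff g 0}"

lemma local_subringI: "\<not> q dvd coeff g 0 \<Longrightarrow> int_eval f y / int_eval g y \<in> local_subring q y"
  by (auto simp: local_subring_def)

text \<open>The divisibility conditions admit q = 0 as well as primes. \<open>relations\<close> says
  that the kernel of evaluation at y lies in (q, X); in particular the denominators in
  \<open>local_subring\<close> do not vanish.\<close>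

locale prime_below =
  fixes q :: int and x y :: "'k::field"
  assumes xy: "x * y = 1"
    and not_unit: "\<not> q dvd 1"
    and prime: "\<And>a b. q dvd a * b \<Longrightarrow> q dvd a \<or> q dvd b"
    and relations: "\<And>g. int_eval g y = 0 \<Longrightarrow> q dvd coeff g 0"
begin

lemma y_nonzero: "y \<noteq> 0"
  using xy by auto

lemma int_eval_in_local: "int_eval f y \<in> local_subring q y"
  using local_subringI[of q 1 f y] not_unit by simp

lemma coeff_0_mult: "\<not> q dvd coeff f 0 \<Longrightarrow> \<not> q dvd coeff g 0 \<Longrightarrow> \<not> q dvd coeff (f * g) 0"
  using prime by (auto simp: coeff_mult)

lemma is_subring_local: "is_subring (local_subring q y)"
  unfolding is_subring_def
proof (intro conjI ballI)
  show "1 \<in> local_subring q y"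
    using int_eval_in_local[of 1] by simp
  fix a assume "a \<in> local_subring q y"
  then obtain f g where a: "a = int_eval f y / int_eval g y" "\<not> q dvd coeff g 0"
    by (auto simp: local_subring_def)
  show "- a \<in> local_subring q y"
    using local_subringI[OF a(2), of "- f" y] by (simp add: a(1))
  fix b assume "b \<in> local_subring q y"
  then obtain f' g' where b: "b = int_eval f' y / int_eval g' y" "\<not> q dvd coeff g' 0"
    by (auto simp: local_subring_def)
  have nz: "int_eval g y \<noteq> 0" "int_eval g' y \<noteq> 0" using relations a b by auto
  show "a + b \<in> local_subring q y"
    using local_subringI[OF coeff_0_mult[OF a(2) b(2)], of "f * g' + f' * g" y] nz
    by (simp add: a(1) b(1) add_frac_eq)
  show "a * b \<in> local_subring q y"
    using local_subringI[OF coeff_0_mult[OF a(2) b(2)], of "f * f'" y]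
    by (simp add: a(1) b(1))
qed

text \<open>From 1/y = f(y)/g(y) one gets the relation g - X f, which has the constant term of
  g.\<close>

lemma inverse_notin_local: "inverse y \<notin> local_subring q y"
proof
  assume "inverse y \<in> local_subring q y"
  then obtain f g where fg: "inverse y = int_eval f y / int_eval g y" "\<not> q dvd coeff g 0"
    by (auto simp: local_subring_def)
  then have "int_eval g y \<noteq> 0" using relations by blast
  then have "int_eval (g - pCons 0 f) y = 0"
    using fg(1) y_nonzero by (simp add: field_simps)
  from relations[OF this] fg(2) show False by simp
qed

lemma archimedean_local:
  assumes "\<And>f. int_eval f y \<noteq> 0 \<Longrightarrow> \<exists>b\<in>local_subring q y. \<exists>k. int_eval f y * b = y ^ k"
  shows "archimedean_subring y (local_subring q y)"
proof -
  have "\<exists>b\<in>local_subring q y. \<exists>k. a * b = y ^ k" if a: "a \<in> local_subring q y" "a \<noteq> 0" for a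
  proof -
    obtain f g where fg: "a = int_eval f y / int_eval g y" "\<not> q dvd coeff g 0"
      using a(1) by (auto simp: local_subring_def)
    then obtain b k where b: "b \<in> local_subring q y" "int_eval f y * b = y ^ k"
      using assms[of f] a(2) by auto
    have "int_eval g y * b \<in> local_subring q y"
      using b(1) int_eval_in_local is_subring_local by (blast intro: subring_mult)
    moreover have "a * (int_eval g y * b) = y ^ k"
      using fg a(2) b(2) by auto
    ultimately show ?thesis by blast
  qed
  moreover have "y \<in> local_subring q y"
    using int_eval_in_local[of "[:0, 1:]"] by simp
  ultimately show ?thesis
    using is_subring_local inverse_notin_local by (simp add: archimedean_subring_def)
qed

text \<open>When q vanishes in the field, splitting f modulo q gives f(y) = y^k g(y) with g(y) a
  unit.\<close>

lemma archimedean_local_residue: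
  assumes "of_int q = (0::'k)"
  shows "archimedean_subring y (local_subring q y)"
proof (rule archimedean_local)
  fix f assume f: "int_eval f y \<noteq> 0"
  have "\<not> (\<forall>i. q dvd coeff f i)"
  proof
    assume "\<forall>i. q dvd coeff f i"
    then obtain g where "f = smult q g"
      using const_poly_dvd_iff[of q f] by (auto simp: dvd_def)
    with f assms show False by simp
  qed
  then obtain k g r where g: "f = monom 1 k * g + smult q r" "\<not> q dvd coeff g 0"
    using split_off_residual_part by blast
  then have "int_eval g y \<noteq> 0" using relations by blast
  then have "int_eval f y * (int_eval 1 y / int_eval g y) = y ^ k" using assms by (simp add: g(1))
  then show "\<exists>b\<in>local_subring q y. \<exists>k. int_eval f y * b = y ^ k"
    using local_subringI[OF g(2)] by blast
qed

text \<open>An integer n that vanishes in the field is a constant relation, so q divides it; the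
  quotient vanishes too, and descent forces n = 0.\<close>

lemma of_int_nonzero:
  assumes q: "of_int q \<noteq> (0::'k)"
  shows "of_int n = (0::'k) \<Longrightarrow> n = 0"
proof (induction "nat \<bar>n\<bar>" arbitrary: n rule: less_induct)
  case less
  have "q dvd n" using relations[of "[:n:]"] less.prems by simp
  then obtain m where m: "n = q * m" by blast
  then have "of_int m = (0::'k)" using less.prems q by simp
  show ?case
  proof (rule ccontr)
    assume "n \<noteq> 0"
    then have "m \<noteq> 0" "\<bar>q\<bar> \<noteq> 0" using m by auto
    moreover have "\<bar>q\<bar> \<noteq> 1" using not_unit by auto
    ultimately have "1 * \<bar>m\<bar> < \<bar>q\<bar> * \<bar>m\<bar>" by (intro mult_strict_right_mono) auto
    then have "nat \<bar>m\<bar> < nat \<bar>n\<bar>" by (simp add: m abs_mult)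
    from less.hyps[OF this \<open>of_int m = 0\<close>] \<open>m \<noteq> 0\<close> show False by simp
  qed
qed

text \<open>The primitive part of a relation is nonzero modulo q, so splitting it expresses y^k h(y)
  as a multiple of q with h(y) a unit.\<close>

lemma power_divisible:
  assumes q: "of_int q \<noteq> (0::'k)" and g: "g \<noteq> 0" "int_eval g y = 0"
  obtains k w where "w \<in> local_subring q y" "y ^ k = of_int q * w"
proof -
  have "content g \<noteq> 0" using g by simp
  then have "of_int (content g) \<noteq> (0::'k)" using of_int_nonzero[OF q] by blast
  moreover have "of_int (content g) * int_eval (primitive_part g) y = 0"
    using g(2) by (simp flip: int_eval_smult)
  ultimately have pp: "int_eval (primitive_part g) y = 0" by simp
  have "\<not> (\<forall>i. q dvd coeff (primitive_part g) i)"
  proof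
    assume "\<forall>i. q dvd coeff (primitive_part g) i"
    then have "q dvd content (primitive_part g)"
      by (simp add: const_poly_dvd_iff flip: const_poly_dvd_iff_dvd_content)
    with g(1) not_unit show False by simp
  qed
  then obtain k h r where h: "primitive_part g = monom 1 k * h + smult q r" "\<not> q dvd coeff h 0"
    using split_off_residual_part by blast
  then have "int_eval h y \<noteq> 0" using relations by blast
  moreover have "y ^ k * int_eval h y + of_int q * int_eval r y = 0"
    using pp by (simp add: h(1))
  ultimately have "y ^ k = of_int q * (int_eval (- r) y / int_eval h y)"
    by (simp add: field_simps eq_neg_iff_add_eq_0)
  with local_subringI[OF h(2)] show ?thesis by (rule that)
qed

text \<open>f(y) divides a nonzero integer q^j u with u prime to q. Here u is a unit and q divides
  y^k, so f(y) divides y^(k j).\<close>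

lemma archimedean_local_algebraic:
  assumes q: "of_int q \<noteq> (0::'k)" and g: "g \<noteq> 0" "int_eval g y = 0"
  shows "archimedean_subring y (local_subring q y)"
proof (rule archimedean_local)
  note R = is_subring_local
  fix f assume "int_eval f y \<noteq> 0"
  then obtain h n where h: "n \<noteq> 0" "int_eval f y * int_eval h y = of_int n"
    using int_eval_dvd_of_int[OF of_int_nonzero[OF q]] g by blast
  obtain u where u: "n = q ^ multiplicity q n * u" "\<not> q dvd u"
    using multiplicity_decompose'[OF h(1), of q] not_unit by blast
  define j where "j = multiplicity q n"
  obtain k w where w: "w \<in> local_subring q y" "y ^ k = of_int q * w"
    using power_divisible[OF q g] by blast
  have nz: "of_int u \<noteq> (0::'k)" using of_int_nonzero[OF q] u(2) by auto
  have inv: "1 / of_int u \<in> local_subring q y"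
    using local_subringI[of q "[:u:]" 1 y] u(2) by simp
  let ?b = "int_eval h y * (w ^ j * (1 / of_int u))"
  have "?b \<in> local_subring q y"
    using int_eval_in_local w(1) inv by (intro subring_mult[OF R] subring_power[OF R])
  moreover have "int_eval f y * ?b = of_int n * w ^ j * (1 / of_int u)"
    unfolding h(2)[symmetric] by simp
  then have "int_eval f y * ?b = (y ^ k) ^ j"
    using nz unfolding w(2) by (subst (asm) u(1)) (simp add: j_def power_mult_distrib)
  then have "int_eval f y * ?b = y ^ (k * j)" by (simp add: power_mult)
  ultimately show "\<exists>b\<in>local_subring q y. \<exists>k. int_eval f y * b = y ^ k" by blast
qed

end

text \<open>The constant terms of the integer relations of \<open>y\<close> form a proper ideal of the integers; \<open>q\<close> is
  a prime number dividing all of them, or \<open>0\<close> if the ideal vanishes.\<close>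

lemma exists_archimedean_subring:
  fixes x y :: "'k::field"
  assumes xy: "x * y = 1" and nonint: "\<And>h. 1 + y * int_eval h y \<noteq> 0"
  shows "\<exists>W. archimedean_subring y W"
proof -
  define I where "I = {coeff g 0 | g. int_eval g y = 0}"
  \<comment> \<open>Closure under remainders makes the least positive element of \<open>I\<close>
    divide all the others.\<close>
  have I_mod: "a mod d \<in> I" if ad: "a \<in> I" "d \<in> I" for a d
  proof -
    obtain f g where "a = coeff f 0" "int_eval f y = 0" "d = coeff g 0" "int_eval g y = 0"
      using ad by (auto simp: I_def)
    then have "a mod d = coeff (f - smult (a div d) g) 0" "int_eval (f - smult (a div d) g) y = 0"
      by (simp_all add: minus_mult_div_eq_mod mult.commute)
    then show ?thesis unfolding I_def by blast
  qed
  have I_minus: "- a \<in> I" if a: "a \<in> I" for a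
  proof -
    obtain f where "a = coeff f 0" "int_eval f y = 0" using a by (auto simp: I_def)
    then have "- a = coeff (- f) 0" "int_eval (- f) y = 0" by simp_all
    then show ?thesis unfolding I_def by blast
  qed
  have "1 \<notin> I"
  proof
    assume "1 \<in> I"
    then obtain f where f: "coeff f 0 = 1" "int_eval f y = 0" by (auto simp: I_def)
    obtain c h where "f = pCons c h" by (cases f)
    with f nonint[of h] show False by simp
  qed
  show ?thesis
  proof (cases "I \<subseteq> {0}")
    case True
    interpret prime_below 0 x y
      using True xy by unfold_locales (auto simp: I_def)
    show ?thesis using archimedean_local_residue by auto
  next
    case False
    then obtain a where "a \<in> I" "a \<noteq> 0" by blast
    then have "\<exists>d>0. int d \<in> I"
      using I_minus[of a] by (cases a rule: int_cases2) auto
    define d where "d = (LEAST d. d > 0 \<and> int d \<in> I)"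
    have d: "d > 0" "int d \<in> I" and d_min: "\<And>e. e < d \<Longrightarrow> e > 0 \<Longrightarrow> int e \<notin> I"
      using LeastI_ex[OF \<open>\<exists>d>0. int d \<in> I\<close>] not_less_Least[of _ "\<lambda>d. d > 0 \<and> int d \<in> I"]
      unfolding d_def by blast+
    have dvd: "int d dvd a" if "a \<in> I" for a
    proof (rule ccontr)
      assume "\<not> int d dvd a"
      then have "a mod int d \<noteq> 0" by (blast intro: mod_0_imp_dvd)
      moreover have "a mod int d \<ge> 0" "a mod int d < int d" using d(1) by simp_all
      ultimately have "a mod int d > 0" "a mod int d < int d" by simp_all
      then have "nat (a mod int d) < d" "nat (a mod int d) > 0" "int (nat (a mod int d)) = a mod int d"
        by (simp_all add: nat_less_iff)
      then show False using d_min I_mod[OF that d(2)] by metis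
    qed
    have "d \<noteq> 1" using d(2) \<open>1 \<notin> I\<close> by auto
    then obtain p where p: "prime p" "p dvd d" using prime_factor_nat by blast
    interpret prime_below "int p" x y
    proof
      show "x * y = 1" by fact
      show "\<not> int p dvd 1" using p(1) by auto
      show "int p dvd a \<or> int p dvd b" if "int p dvd a * b" for a b
        using p(1) that by (simp add: prime_dvd_mult_iff)
      show "int p dvd coeff g 0" if "int_eval g y = 0" for g
        using dvd[of "coeff g 0"] p(2) that by (force simp: I_def intro: dvd_trans)
    qed
    show ?thesis
    proof (cases "of_int (int p) = (0::'k)")
      case True
      then show ?thesis using archimedean_local_residue by blast
    next
      \<comment> \<open>The relation with constant term d is nonzero, so y is algebraic.\<close>
      case p_nz: False
      obtain g where g: "int d = coeff g 0" "int_eval g y = 0" using d(2) by (auto simp: I_def)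
      with d(1) have "g \<noteq> 0" by auto
      with archimedean_local_algebraic[OF p_nz _ g(2)] show ?thesis by blast
    qed
  qed
qed

section \<open>Reduction to a field\<close>

definition prime_ideal :: "'a::comm_ring_1 set \<Rightarrow> bool" where
  "prime_ideal P \<longleftrightarrow> 0 \<in> P \<and> (\<forall>a\<in>P. \<forall>b\<in>P. a + b \<in> P) \<and> (\<forall>a\<in>P. \<forall>r. r * a \<in> P) \<and> 1 \<notin> P \<and>
     (\<forall>a b. a * b \<in> P \<longrightarrow> a \<in> P \<or> b \<in> P)"

text \<open>An ideal P maximal among those disjoint from M is prime: for a and b outside P, both P +
  (a) and P + (b) meet M, and the product of the two elements found would lie in P if a b
  did.\<close>

lemma exists_prime_ideal_avoiding:
  fixes M :: "'a::comm_ring_1 set"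
  assumes M: "1 \<in> M" "0 \<notin> M" "\<And>a b. a \<in> M \<Longrightarrow> b \<in> M \<Longrightarrow> a * b \<in> M"
  shows "\<exists>P. prime_ideal P \<and> P \<inter> M = {}"
proof -
  define ideal where "ideal P \<longleftrightarrow> 0 \<in> P \<and> (\<forall>a\<in>P. \<forall>b\<in>P. a + b \<in> P) \<and> (\<forall>a\<in>P. \<forall>r. r * a \<in> P)"
    for P :: "'a set"
  let ?A = "{P. ideal P \<and> P \<inter> M = {}}"
  have "\<exists>P\<in>?A. \<forall>X\<in>?A. P \<subseteq> X \<longrightarrow> X = P"
  proof (rule subset_Zorn_nonempty)
    have "{0} \<in> ?A" using M(2) by (simp add: ideal_def)
    then show "?A \<noteq> {}" by blast
    fix C assume C: "C \<noteq> {}" "subset.chain ?A C"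
    have CA: "ideal P" "P \<inter> M = {}" if "P \<in> C" for P
      using C(2) that by (auto simp: subset_chain_def)
    have "a + b \<in> \<Union>C" if ab: "a \<in> \<Union>C" "b \<in> \<Union>C" for a b
    proof -
      obtain P1 P2 where P: "P1 \<in> C" "P2 \<in> C" "a \<in> P1" "b \<in> P2" using ab by blast
      moreover have "P1 \<subseteq> P2 \<or> P2 \<subseteq> P1"
        using C(2) P(1,2) by (auto simp: subset_chain_def)
      ultimately obtain P where "P \<in> C" "a \<in> P" "b \<in> P" by blast
      with CA(1) show ?thesis unfolding ideal_def by blast
    qed
    moreover have "0 \<in> \<Union>C" "\<forall>a\<in>\<Union>C. \<forall>r. r * a \<in> \<Union>C"
      using C(1) CA(1) unfolding ideal_def by blast+
    ultimately have "ideal (\<Union>C)" unfolding ideal_def by blast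
    moreover have "\<Union>C \<inter> M = {}" using CA(2) by blast
    ultimately show "\<Union>C \<in> ?A" by blast
  qed
  then obtain P where "P \<in> ?A" and max: "\<forall>X\<in>?A. P \<subseteq> X \<longrightarrow> X = P" by (rule bexE)
  then have "ideal P" and PM: "P \<inter> M = {}" by simp_all
  then have P: "0 \<in> P" "\<And>a b. a \<in> P \<Longrightarrow> b \<in> P \<Longrightarrow> a + b \<in> P" "\<And>a r. a \<in> P \<Longrightarrow> r * a \<in> P"
    unfolding ideal_def by blast+
  have meets: "\<exists>p\<in>P. \<exists>r. p + r * a \<in> M" if "a \<notin> P" for a
  proof (rule ccontr)
    assume contra: "\<not> ?thesis"
    define Q where "Q = {p + r * a | p r. p \<in> P}"
    have "ideal Q"
      unfolding ideal_def
    proof (intro conjI ballI allI)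
      have "0 = 0 + 0 * a" by simp
      then show "0 \<in> Q" using P(1) unfolding Q_def by blast
      fix u assume "u \<in> Q"
      then obtain p r where u: "p \<in> P" "u = p + r * a" by (auto simp: Q_def)
      show "s * u \<in> Q" for s
      proof -
        have "s * u = s * p + (s * r) * a" by (simp add: u algebra_simps)
        then show ?thesis using P(3)[OF u(1)] unfolding Q_def by blast
      qed
      fix v assume "v \<in> Q"
      then obtain p' r' where v: "p' \<in> P" "v = p' + r' * a" by (auto simp: Q_def)
      have "u + v = (p + p') + (r + r') * a" by (simp add: u v algebra_simps)
      then show "u + v \<in> Q" using P(2)[OF u(1) v(1)] unfolding Q_def by blast
    qed
    moreover have "Q \<inter> M = {}" using contra by (auto simp: Q_def)
    moreover have "p \<in> Q" if "p \<in> P" for p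
    proof -
      have "p = p + 0 * a" by simp
      then show ?thesis using that unfolding Q_def by blast
    qed
    ultimately have "Q = P" using max by blast
    moreover have "a = 0 + 1 * a" by simp
    then have "a \<in> Q" using P(1) unfolding Q_def by blast
    ultimately show False using \<open>a \<notin> P\<close> by blast
  qed
  have "a \<in> P \<or> b \<in> P" if ab: "a * b \<in> P" for a b
  proof (rule ccontr)
    assume "\<not> (a \<in> P \<or> b \<in> P)"
    then obtain p r p' r' where m: "p \<in> P" "p + r * a \<in> M" "p' \<in> P" "p' + r' * b \<in> M"
      using meets by blast
    have "(p' + r' * b) * p + ((r * a) * p' + (r * r') * (a * b)) \<in> P"
      using m P ab by simp
    moreover have "(p' + r' * b) * p + ((r * a) * p' + (r * r') * (a * b)) = (p + r * a) * (p' + r' * b)"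
      by (simp add: algebra_simps)
    ultimately show False using M(3)[OF m(2,4)] PM by auto
  qed
  moreover have "1 \<notin> P" using M(1) PM by blast
  ultimately have "prime_ideal P" using P unfolding prime_ideal_def by blast
  with PM show ?thesis by blast
qed

text \<open>If some unit \<open>x\<close> is not integral over the prime ring, then it stays so modulo this prime ideal.
  A type of residue classes must not depend on variables, hence the choice.\<close>

definition residue_ideal :: "'a::comm_ring_1 set" where
  "residue_ideal = (SOME P. prime_ideal P \<and>
     ((\<exists>x y::'a. x * y = 1 \<and> (\<forall>h. 1 + y * int_eval h y \<noteq> 0)) \<longrightarrow>
      (\<exists>x y. x * y = 1 \<and> (\<forall>h. 1 + y * int_eval h y \<notin> P))))"

text \<open>The elements 1 + y h(y) are closed under products and avoid 0, so some prime ideal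
  avoids them all.\<close>

lemma residue_ideal:
  "prime_ideal (residue_ideal :: 'a::comm_ring_1 set)"
  "(\<exists>x y::'a. x * y = 1 \<and> (\<forall>h. 1 + y * int_eval h y \<noteq> 0)) \<Longrightarrow>
    \<exists>x y::'a. x * y = 1 \<and> (\<forall>h. 1 + y * int_eval h y \<notin> residue_ideal)"
proof -
  let ?good = "\<lambda>P::'a set. prime_ideal P \<and>
    ((\<exists>x y::'a. x * y = 1 \<and> (\<forall>h. 1 + y * int_eval h y \<noteq> 0)) \<longrightarrow>
     (\<exists>x y. x * y = 1 \<and> (\<forall>h. 1 + y * int_eval h y \<notin> P)))"
  have "\<exists>P. ?good P"
  proof (cases "\<exists>x y::'a. x * y = 1 \<and> (\<forall>h. 1 + y * int_eval h y \<noteq> 0)")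
    case True
    then obtain x y :: 'a where xy: "x * y = 1" "\<And>h. 1 + y * int_eval h y \<noteq> 0" by blast
    define M where "M = {1 + y * int_eval h y | h. True}"
    have "\<exists>P. prime_ideal P \<and> P \<inter> M = {}"
    proof (rule exists_prime_ideal_avoiding)
      have "1 = 1 + y * int_eval 0 y" by simp
      then show "1 \<in> M" unfolding M_def by blast
      show "0 \<notin> M" using xy(2) by (force simp: M_def)
      fix a b assume "a \<in> M" "b \<in> M"
      then obtain g h where gh: "a = 1 + y * int_eval g y" "b = 1 + y * int_eval h y"
        by (auto simp: M_def)
      have "a * b = 1 + y * int_eval (g + h + pCons 0 (g * h)) y"
        by (simp add: gh algebra_simps)
      then show "a * b \<in> M" unfolding M_def by blast
    qed
    then obtain P where P: "prime_ideal P" "P \<inter> M = {}" by blast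
    have "1 + y * int_eval h y \<notin> P" for h using P(2) unfolding M_def by blast
    with xy(1) have "\<exists>x y. x * y = 1 \<and> (\<forall>h. 1 + y * int_eval h y \<notin> P)" by blast
    with P(1) have "?good P" by (intro conjI impI)
    then show ?thesis by (rule exI[of ?good P])
  next
    case False
    \<comment> \<open>The quotient type must exist for every ring; without such a unit any prime
      ideal serves.\<close>
    have "\<exists>P::'a set. prime_ideal P \<and> P \<inter> {1} = {}"
      by (rule exists_prime_ideal_avoiding) auto
    then obtain P :: "'a set" where P: "prime_ideal P" by blast
    have "?good P" by (intro conjI impI) (rule P, erule notE[OF False])
    then show ?thesis by (rule exI[of ?good P])
  qed
  then have "?good residue_ideal" unfolding residue_ideal_def by (rule someI_ex)
  note * = conjunct1[OF this] conjunct2[OF this, THEN mp]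
  from *(1) show "prime_ideal (residue_ideal :: 'a set)" .
  show "\<exists>x y::'a. x * y = 1 \<and> (\<forall>h. 1 + y * int_eval h y \<notin> residue_ideal)"
    if "\<exists>x y::'a. x * y = 1 \<and> (\<forall>h. 1 + y * int_eval h y \<noteq> 0)"
    using that by (rule *(2))
qed

lemma residue_ideal_zero: "0 \<in> residue_ideal"
  and residue_ideal_add: "a \<in> residue_ideal \<Longrightarrow> b \<in> residue_ideal \<Longrightarrow> a + b \<in> residue_ideal"
  and residue_ideal_mult: "a \<in> residue_ideal \<Longrightarrow> r * a \<in> residue_ideal"
  and residue_ideal_one: "1 \<notin> residue_ideal"
  and residue_ideal_prime: "a * b \<in> residue_ideal \<Longrightarrow> a \<in> residue_ideal \<or> b \<in> residue_ideal"
  using residue_ideal(1) unfolding prime_ideal_def by blast+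

lemma residue_ideal_uminus: "a \<in> residue_ideal \<Longrightarrow> - a \<in> residue_ideal"
  using residue_ideal_mult[of a "-1"] by simp

\<comment> \<open>The quotient by the chosen prime ideal and its fraction field\<close>
quotient_type (overloaded) 'a residue = "'a::comm_ring_1" / "\<lambda>a b. a - b \<in> residue_ideal"
proof (rule equivpI)
  show "reflp (\<lambda>a b::'a. a - b \<in> residue_ideal)"
    by (simp add: reflp_def residue_ideal_zero)
  show "symp (\<lambda>a b::'a. a - b \<in> residue_ideal)"
    unfolding symp_def using residue_ideal_uminus by (metis minus_diff_eq)
  show "transp (\<lambda>a b::'a. a - b \<in> residue_ideal)"
  proof (rule transpI)
    fix a b c :: 'a assume "a - b \<in> residue_ideal" "b - c \<in> residue_ideal"
    from residue_ideal_add[OF this] show "a - c \<in> residue_ideal" by simp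
  qed
qed

instantiation residue :: (comm_ring_1) comm_ring_1
begin

lift_definition zero_residue :: "'a residue" is 0 .
lift_definition one_residue :: "'a residue" is 1 .
lift_definition plus_residue :: "'a residue \<Rightarrow> 'a residue \<Rightarrow> 'a residue" is "(+)"
  using residue_ideal_add by (simp add: add_diff_add)
lift_definition uminus_residue :: "'a residue \<Rightarrow> 'a residue" is uminus
  using residue_ideal_uminus by (metis minus_diff_minus)
lift_definition minus_residue :: "'a residue \<Rightarrow> 'a residue \<Rightarrow> 'a residue" is "(-)"
proof -
  fix a b c d :: 'a assume "a - b \<in> residue_ideal" "c - d \<in> residue_ideal"
  from residue_ideal_add[OF this(1) residue_ideal_uminus[OF this(2)]]
  show "a - c - (b - d) \<in> residue_ideal" by (simp add: algebra_simps)
qed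
lift_definition times_residue :: "'a residue \<Rightarrow> 'a residue \<Rightarrow> 'a residue" is "(*)"
proof -
  fix a b c d :: 'a assume "a - b \<in> residue_ideal" "c - d \<in> residue_ideal"
  from residue_ideal_add[OF residue_ideal_mult[OF this(1), of c] residue_ideal_mult[OF this(2), of b]]
  show "a * c - b * d \<in> residue_ideal" by (simp add: algebra_simps)
qed

instance
proof
  fix a b c :: "'a residue"
  show "a + b + c = a + (b + c)" "a + b = b + a" "0 + a = a" "- a + a = 0" "a - b = a + - b"
    "a * b * c = a * (b * c)" "a * b = b * a" "1 * a = a" "(a + b) * c = a * c + b * c"
    by (transfer; simp add: algebra_simps residue_ideal_zero)+
  show "(0 :: 'a residue) \<noteq> 1"
    by transfer (use residue_ideal_one residue_ideal_uminus in force)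
qed

end

instance residue :: (comm_ring_1) idom
proof
  show "a \<noteq> 0 \<Longrightarrow> b \<noteq> 0 \<Longrightarrow> a * b \<noteq> 0" for a b :: "'a residue"
    by transfer (use residue_ideal_prime in auto)
qed

lift_definition residue_class :: "'a::comm_ring_1 \<Rightarrow> 'a residue" is "\<lambda>a. a" .

definition to_field :: "'a::comm_ring_1 \<Rightarrow> 'a residue fract" where
  "to_field a = Fract (residue_class a) 1"

lemma to_field_add: "to_field (a + b) = to_field a + to_field b"
  and to_field_mult: "to_field (a * b) = to_field a * to_field b"
  and to_field_uminus: "to_field (- a) = - to_field a"
proof -
  have "residue_class (a + b) = residue_class a + residue_class b"
    "residue_class (a * b) = residue_class a * residue_class b"
    "residue_class (- a) = - residue_class a"
    by (transfer; simp add: residue_ideal_zero)+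
  then show "to_field (a + b) = to_field a + to_field b"
    "to_field (a * b) = to_field a * to_field b" "to_field (- a) = - to_field a"
    by (simp_all add: to_field_def)
qed

lemma to_field_one: "to_field (1 :: 'a::comm_ring_1) = 1"
proof -
  have "residue_class (1 :: 'a) = 1" by transfer (simp add: residue_ideal_zero)
  then show ?thesis by (simp add: to_field_def One_fract_def)
qed

lemma to_field_eq_0_iff: "to_field a = 0 \<longleftrightarrow> a \<in> residue_ideal"
proof -
  have "residue_class a = 0 \<longleftrightarrow> a \<in> residue_ideal" by transfer simp
  then show ?thesis by (simp add: to_field_def Zero_fract_def eq_fract)
qed

lemma to_field_zero: "to_field 0 = 0"
  by (simp add: to_field_eq_0_iff residue_ideal_zero)

lemma to_field_power: "to_field (a ^ n) = to_field a ^ n"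
  by (induction n) (simp_all add: to_field_one to_field_mult)

lemma to_field_of_int: "to_field (of_int n) = of_int n"
proof -
  have "to_field (of_nat m) = of_nat m" for m
    by (induction m) (simp_all add: to_field_zero to_field_one to_field_add)
  then show ?thesis by (cases n rule: int_cases2) (simp_all add: to_field_uminus)
qed

lemma to_field_int_eval: "to_field (int_eval h a) = int_eval h (to_field a)"
  by (induction h) (simp_all add: to_field_zero to_field_add to_field_mult to_field_of_int)

lemma exists_conch_maximal_subring:
  fixes x y :: "'a::comm_ring_1"
  assumes "x * y = 1" "\<And>h. 1 + y * int_eval h y \<noteq> 0"
  shows "\<exists>V::'a set. conch_maximal_subring V"
proof -
  \<comment> \<open>The given pair is replaced: the chosen ideal is only known to work for some
    pair.\<close>
  obtain x y :: 'a where xy: "x * y = 1" and y: "\<And>h. 1 + y * int_eval h y \<notin> residue_ideal"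
    using residue_ideal(2) assms by blast
  have xy': "to_field x * to_field y = 1"
    by (simp add: xy to_field_one flip: to_field_mult)
  have "1 + to_field y * int_eval h (to_field y) \<noteq> 0" for h
  proof -
    have "1 + to_field y * int_eval h (to_field y) = to_field (1 + y * int_eval h y)"
      by (simp add: to_field_add to_field_one to_field_mult to_field_int_eval)
    then show ?thesis using y by (simp add: to_field_eq_0_iff)
  qed
  then obtain W where "archimedean_subring (to_field y) W"
    using exists_archimedean_subring[OF xy'] by blast
  then obtain V where V: "is_subring V" "to_field y \<in> V" "to_field x \<notin> V"
    "\<And>t. \<exists>n. to_field y ^ n * t \<in> V"
    using power_multiple_in_subring[OF xy'] by blast
  \<comment> \<open>The preimage of V inherits y in, x out and the clearing of denominators by
    powers of y, because the map is a ring homomorphism.\<close>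
  let ?R = "{a. to_field a \<in> V}"
  have "is_subring ?R"
    using V(1) unfolding is_subring_def
    by (simp add: to_field_one to_field_add to_field_mult to_field_uminus)
  moreover have "\<exists>n. y ^ n * t \<in> ?R" for t
    using V(4)[of "to_field t"] by (simp add: to_field_mult to_field_power)
  ultimately show ?thesis
    using V(2,3) by (intro conch_maximal_subring_above[OF xy, of ?R]) simp_all
qed

theorem theorem2p4:
  assumes "(1::'a::comm_ring_1) \<noteq> 0"
  shows "(\<exists>V::'a set. conch_maximal_subring V) \<or>
         (\<forall>R::'a set. is_subring R \<longrightarrow> units_in R = R \<inter> {u. u dvd 1})"
proof (rule disjCI)
  assume "\<not> (\<forall>R::'a set. is_subring R \<longrightarrow> units_in R = R \<inter> {u. u dvd 1})"
  then obtain R :: "'a set" where R: "is_subring R" "units_in R \<noteq> R \<inter> {u. u dvd 1}" by blast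
  have "units_in R \<subseteq> R \<inter> {u. u dvd 1}" by (auto simp: units_in_def) (metis dvd_triv_left)
  with R(2) obtain y where y: "y \<in> R" "y dvd 1" "y \<notin> units_in R" by blast
  from y(2) obtain x where x: "1 = y * x" by (rule dvdE)
  then have xy: "x * y = 1" by (simp add: mult.commute)
  have "x \<notin> R" using x y by (auto simp: units_in_def)
  \<comment> \<open>Multiplying 1 + y h(y) = 0 by x would give x = - h(y), an element of R.\<close>
  have "1 + y * int_eval h y \<noteq> 0" for h
  proof
    assume "1 + y * int_eval h y = 0"
    then have "x * (1 + y * int_eval h y) = 0" by simp
    also have "x * (1 + y * int_eval h y) = x + (x * y) * int_eval h y" by (simp add: algebra_simps)
    finally have "x = - int_eval h y" by (simp add: xy eq_neg_iff_add_eq_0)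
    with \<open>x \<notin> R\<close> subring_uminus[OF R(1) int_eval_in_subring[OF R(1) y(1), of h]] show False by simp
  qed
  from exists_conch_maximal_subring[OF xy this] show "\<exists>V::'a set. conch_maximal_subring V" .
qed

end
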